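(* Assume the smoothness assumption stated in the context. Let $\rho_\ast\in\mathcal P(K)$. Then $\rho_\ast$ is a global minimizer of $\mathcal E$ over $\mathcal P(K)$ if and only if $$\operatorname{supp}(\rho_\ast)\subset\operatorname*{argmin}_{\omega\in K}\Phi(\omega;\rho_\ast).$$ Equivalently, $\rho_\ast$ is a global minimizer if and only if $$\Phi(\omega;\rho_\ast)\ge\int\Phi(\omega';\rho_\ast)\,\rho_\ast(d\omega')\quad\text{for all }\omega\in K,$$ with equality for $\rho_\ast$-almost every $\omega$.
   Context: Model. Fix positive integers $L,d_x,d_k,d_v$ and a fixed matrix $W_{\mathrm{out}}\in\mathbb R^{d_x\times d_v}$. A head parameter is $\omega=(W_Q,W_K,W_V,W_O)\in\mathbb R^{d_x\times d_k}\times\mathbb R^{d_x\times d_k}\times\mathbb R^{d_x\times d_k}\times\mathbb R^{d_k\times d_x}$, identified with a vector in $\mathbb R^{d_\omega}$. For an input $X\in\mathbb R^{L\times d_x}$ (rows are tokens), the causally masked attention matrix $A_\omega(X)\in\mathbb R^{L\times L}$ has entries $$A_\omega(X)_{rs}=\frac{\exp\big((XW_QW_K^\top X^\top)_{rs}/\sqrt{d_k}\big)}{\sum_{s'\le r}\exp\big((XW_QW_K^\top X^\top)_{rs'}/\sqrt{d_k}\big)}\ (s\le r),\qquad A_\omega(X)_{rs}=0\ (s>r).$$ $\psi_l(X;\omega)\in\mathbb R^{d_v}$ is the $l$-th row of $A_\omega(X)XW_VW_OW_{\mathrm{out}}$, $l=1,\dots,L$. Data and risk. $X$ is a random input and $Y_l(X)\in\mathbb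 R^{d_v}$ is a one-hot label for each $l$; $\mathbb E_X$ is expectation over $X$. $\mathrm{softmax}_j(z)=e^{z_j}/\sum_m e^{z_m}$. For a probability measure $\rho$ on $\mathbb R^{d_\omega}$, $z_l^\rho(X)=\int\psi_l(X;\omega)\,\rho(d\omega)$. The cross-entropy loss is $\ell(y,z)=\log\big(\sum_{j=1}^{d_v}e^{z_j}\big)-y^\top z$, the risk is $\mathcal E(\rho)=\mathbb E_X\big[\frac1L\sum_{l=1}^L\ell(Y_l(X),z_l^\rho(X))\big]$, and its first variation is $$\Phi(\omega;\rho)=\mathbb E_X\Big[\frac1L\sum_{l=1}^L\big\langle\mathrm{softmax}(z_l^\rho(X))-Y_l(X),\psi_l(X;\omega)\big\rangle\Big].$$ $\mathcal P(K)$ is the set of Borel probability measures on $K$. Smoothness assumption. $K\subset\mathbb R^{d_\omega}$ and $K_x\subset\mathbb R^{d_x}$ are compact, all measures considered are supported in $K$, all input tokens lie in $K_x$ (so $X\in K_x^L$), the maps $\omega\mapsto\psi_l(X;\omega)$ are $C^3$ on $K$ for all $l$ and almost every $X$, and there is $B_\psi<\infty$ with $$\sup_{X\in K_x^L,\,1\le l\le L,\,\omega\in K}\big(\|\psi_l(X;\omega)\|+\|\nabla_\omega\psi_l(X;\omega)\|+\|\nabla^2_\omega\psi_l(X;\omega)\|+\|\nabla^3_\omega\psi_l(X;\omega)\|\big)\le B_\psi.$$ *)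

theory Defs
  imports "HOL-Probability.Probability"
begin

text \<open>
  The index types \<open>'l\<close>, \<open>'x\<close>, \<open>'k\<close>, \<open>'v\<close> stand for \<open>{1..L}\<close>, \<open>{1..d_x}\<close>, \<open>{1..d_k}\<close>, \<open>{1..d_v}\<close>.
  Positions \<open>'l\<close> carry a linear order, which is needed for the causal mask.  An \<open>m \<times> n\<close> matrix has
  type \<open>real ^ 'n ^ 'm\<close> (rows outside), and an input is the matrix whose rows are its tokens.
  The norm and topology of the product type below are those of the Euclidean space of all entries.
\<close>

type_synonym ('x, 'k) head =
  "(real ^ 'k ^ 'x) \<times> (real ^ 'k ^ 'x) \<times> (real ^ 'k ^ 'x) \<times> (real ^ 'x ^ 'k)"

subsection \<open>Attention head\<close>

definition attn_score :: "real ^ 'k ^ 'x \<Rightarrow> real ^ 'k ^ 'x \<Rightarrow> real ^ 'x ^ 'l \<Rightarrow> real ^ 'l ^ 'l" where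
  "attn_score WQ WK X = X ** WQ ** transpose WK ** transpose X"

definition attention ::
    "('x::finite, 'k::finite) head \<Rightarrow> real ^ 'x ^ ('l::{finite,linorder}) \<Rightarrow>
     real ^ ('l::{finite,linorder}) ^ ('l::{finite,linorder})" where
  "attention \<omega> X = (case \<omega> of (WQ, WK, WV, WO) \<Rightarrow>
     (\<chi> r s. if s \<le> r
        then exp (attn_score WQ WK X $ r $ s / sqrt (real CARD('k))) /
             (\<Sum>s' | s' \<le> r. exp (attn_score WQ WK X $ r $ s' / sqrt (real CARD('k))))
        else 0))"

definition psi ::
    "real ^ 'v ^ 'x \<Rightarrow> ('l::{finite,linorder}) \<Rightarrow> real ^ 'x ^ ('l::{finite,linorder}) \<Rightarrow>
     ('x::finite, 'k::finite) head \<Rightarrow> real ^ 'v" where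
  "psi Wout l X \<omega> = (case \<omega> of (WQ, WK, WV, WO) \<Rightarrow>
     (attention \<omega> X ** X ** WV ** WO ** Wout) $ l)"

definition inputs_in :: "(real ^ 'x) set \<Rightarrow> (real ^ 'x ^ 'l) set" where
  "inputs_in Kx = {X. \<forall>l. X $ l \<in> Kx}"

subsection \<open>Probability measures on a compact set and their supports\<close>

text \<open>Elements of \<open>\<P>(K)\<close> are viewed as Borel measures on the whole space giving full mass to \<open>K\<close>.\<close>

definition prob_measures_on :: "'a::topological_space set \<Rightarrow> 'a measure set" where
  "prob_measures_on K = {\<rho>. prob_space \<rho> \<and> sets \<rho> = sets borel \<and> emeasure \<rho> K = 1}"

definition msupp :: "'a::topological_space measure \<Rightarrow> 'a set" where
  "msupp \<rho> = {x. \<forall>U. open U \<and> x \<in> U \<longrightarrow> emeasure \<rho> U > 0}"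

subsection \<open>Risk and first variation\<close>

definition softmax :: "real ^ 'v::finite \<Rightarrow> real ^ 'v" where
  "softmax z = (\<chi> j. exp (z $ j) / (\<Sum>m\<in>UNIV. exp (z $ m)))"

definition ce_loss :: "real ^ 'v::finite \<Rightarrow> real ^ 'v \<Rightarrow> real" where
  "ce_loss y z = ln (\<Sum>j\<in>UNIV. exp (z $ j)) - y \<bullet> z"

definition one_hot :: "real ^ 'v::finite \<Rightarrow> bool" where
  "one_hot y \<longleftrightarrow> (\<exists>j. y = axis j 1)"

definition logit ::
    "real ^ 'v ^ 'x \<Rightarrow> ('x::finite, 'k::finite) head measure \<Rightarrow> ('l::{finite,linorder}) \<Rightarrow>
     real ^ 'x ^ ('l::{finite,linorder}) \<Rightarrow> real ^ 'v::finite" where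
  "logit Wout \<rho> l X = (\<integral>\<omega>. psi Wout l X \<omega> \<partial>\<rho>)"

text \<open>
  The random input is a random variable \<open>X\<close> on a probability space \<open>M\<close>; \<open>Y l x\<close> is the label of
  position \<open>l\<close> for the input \<open>x\<close>.
\<close>

definition risk ::
    "'w measure \<Rightarrow> ('w \<Rightarrow> real ^ 'x ^ ('l::{finite,linorder})) \<Rightarrow>
     ('l::{finite,linorder} \<Rightarrow> real ^ 'x ^ ('l::{finite,linorder}) \<Rightarrow> real ^ 'v) \<Rightarrow>
     real ^ 'v ^ 'x \<Rightarrow>
     ('x::finite, 'k::finite) head measure \<Rightarrow> real" where
  "risk M X Y Wout \<rho> =
     (\<integral>w. (\<Sum>l::'l\<in>UNIV.
              ce_loss (Y l (X w)) (logit Wout \<rho> l (X w))) / real CARD('l) \<partial>M)"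

definition first_variation ::
    "'w measure \<Rightarrow> ('w \<Rightarrow> real ^ 'x ^ ('l::{finite,linorder})) \<Rightarrow>
     ('l::{finite,linorder} \<Rightarrow> real ^ 'x ^ ('l::{finite,linorder}) \<Rightarrow> real ^ 'v) \<Rightarrow>
     real ^ 'v ^ 'x \<Rightarrow>
     ('x::finite, 'k::finite) head \<Rightarrow> ('x, 'k) head measure \<Rightarrow> real" where
  "first_variation M X Y Wout \<omega> \<rho> =
     (\<integral>w. (\<Sum>l::'l\<in>UNIV.
              (softmax (logit Wout \<rho> l (X w)) - Y l (X w)) \<bullet> psi Wout l (X w) \<omega>) / real CARD('l) \<partial>M)"

subsection \<open>Derivatives up to order three\<close>

text \<open>
  \<open>nabla f x\<close> is the Frechet derivative of \<open>f\<close> at \<open>x\<close> as a bounded linear map; iterating it gives the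
  higher derivatives as multilinear maps in curried form, with their operator norms.  The value is
  meaningful only where \<open>f\<close> is differentiable.
\<close>

definition nabla ::
    "('a::real_normed_vector \<Rightarrow> 'b::real_normed_vector) \<Rightarrow> 'a \<Rightarrow> ('a \<Rightarrow>\<^sub>L 'b)" where
  "nabla f x = Blinfun (frechet_derivative f (at x))"

lemma nabla_eqI:
  assumes "(f has_derivative blinfun_apply D) (at x)"
  shows "nabla f x = D"
proof -
  have "frechet_derivative f (at x) = blinfun_apply D"
    using frechet_derivative_at[OF assms] by simp
  then show ?thesis
    by (simp add: nabla_def blinfun_apply_inverse)
qed

text \<open>For a set that need not be open, being \<open>C\<^sup>3\<close> means being \<open>C\<^sup>3\<close> on some open neighbourhood.\<close>

definition C3_on :: "('a::real_normed_vector \<Rightarrow> 'b::real_normed_vector) \<Rightarrow> 'a set \<Rightarrow> bool" where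
  "C3_on f K \<longleftrightarrow> (\<exists>U. open U \<and> K \<subseteq> U \<and>
     (\<forall>x\<in>U. f differentiable at x \<and> nabla f differentiable at x \<and>
             nabla (nabla f) differentiable at x) \<and>
     continuous_on U (nabla (nabla (nabla f))))"

end

theory Submission
  imports Defs
begin

text \<open>
  The risk is a convex functional of \<open>\<rho>\<close>, because the logits are linear in \<open>\<rho>\<close> and the cross entropy
  is convex.  The tangent-plane inequality of the loss, integrated with Fubini's theorem, says that
  the risk increment from \<open>\<rho>\<close> to \<open>\<nu>\<close> is at least \<open>\<integral>\<Phi>(\<cdot>;\<rho>) d\<nu> - \<integral>\<Phi>(\<cdot>;\<rho>) d\<rho>\<close>; conversely, moving a
  little mass of a minimizer to a point \<open>\<omega>\<close> shows \<open>\<Phi>(\<omega>;\<rho>) \<ge> \<integral>\<Phi>(\<cdot>;\<rho>) d\<rho>\<close>.  The support condition is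
  equivalent to this inequality because \<open>\<Phi>(\<cdot>;\<rho>)\<close> is continuous on \<open>K\<close> and \<open>\<rho>\<close> is concentrated on its
  support.
\<close>

subsection \<open>Cross entropy\<close>

lemma softmax_nonneg: "0 \<le> softmax z $ j"
  by (simp add: softmax_def sum_nonneg)

lemma sum_exp_pos: "0 < (\<Sum>m\<in>UNIV. exp ((z :: real ^ 'v::finite) $ m))"
  by (rule sum_pos) auto

lemma sum_exp_neq_0: "(\<Sum>m\<in>UNIV. exp ((z :: real ^ 'v::finite) $ m)) \<noteq> 0"
  using sum_exp_pos[of z] by simp

lemma sum_softmax: "(\<Sum>j\<in>UNIV. softmax z $ j) = 1"
  using sum_exp_pos[of z] by (simp add: softmax_def flip: sum_divide_distrib)

text \<open>The Euclidean norm is at most the l1 norm, which is 1 for a probability vector.\<close>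

lemma norm_softmax_le: "norm (softmax z) \<le> 1"
  using norm_le_l1_cart[of "softmax z"] by (simp add: softmax_nonneg sum_softmax)

lemma continuous_on_softmax: "continuous_on S softmax"
  unfolding softmax_def
  by (intro continuous_intros ballI sum_exp_neq_0)

lemma borel_measurable_softmax[measurable]: "softmax \<in> borel_measurable borel"
  by (intro borel_measurable_continuous_onI continuous_on_softmax)

lemma borel_measurable_ce_loss[measurable]:
  fixes f g :: "'a \<Rightarrow> real ^ 'v::finite"
  assumes [measurable]: "f \<in> borel_measurable M" "g \<in> borel_measurable M"
  shows "(\<lambda>w. ce_loss (f w) (g w)) \<in> borel_measurable M"
proof -
  have [measurable]: "(\<lambda>z :: real ^ 'v. ln (\<Sum>j\<in>UNIV. exp (z $ j))) \<in> borel_measurable borel"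
    by (intro borel_measurable_continuous_onI continuous_intros ballI sum_exp_neq_0)
  show ?thesis unfolding ce_loss_def by measurable
qed

text \<open>By Jensen's inequality, in the form \<open>exp x \<ge> 1 + x\<close>: log-sum-exp lies above its tangent plane.\<close>

lemma ce_loss_gradient_le: "(softmax z - y) \<bullet> (z' - z) \<le> ce_loss y z' - ce_loss y z"
proof -
  let ?S = "\<lambda>z :: real ^ 'a. \<Sum>m\<in>UNIV. exp (z $ m)"
  \<comment> \<open>\<open>a\<close> is the mean of the increments under the softmax weights;
    centring by it makes the linear term average to zero.\<close>
  define a where "a = softmax z \<bullet> (z' - z)"
  have "1 = (\<Sum>j\<in>UNIV. softmax z $ j * (1 + ((z' - z) $ j - a)))"
  proof -
    have "(\<Sum>j\<in>UNIV. softmax z $ j * (1 + ((z' - z) $ j - a)))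
      = (\<Sum>j\<in>UNIV. softmax z $ j) * (1 - a) + softmax z \<bullet> (z' - z)"
      unfolding inner_vec_def sum_distrib_right sum.distrib[symmetric]
      by (intro sum.cong) (auto simp: algebra_simps)
    then show ?thesis by (simp add: sum_softmax a_def)
  qed
  also have "\<dots> \<le> (\<Sum>j\<in>UNIV. softmax z $ j * exp ((z' - z) $ j - a))"
    by (intro sum_mono mult_left_mono softmax_nonneg exp_ge_add_one_self)
  also have "\<dots> = ?S z' / (?S z * exp a)"
    unfolding sum_divide_distrib by (simp add: softmax_def exp_diff)
  finally have "?S z * exp a \<le> ?S z'"
    using sum_exp_pos[of z] by (simp add: field_simps)
  then have "ln (?S z * exp a) \<le> ln (?S z')"
    using sum_exp_pos[of z] by (intro ln_mono) auto
  then have "ln (?S z) + a \<le> ln (?S z')"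
    using sum_exp_pos[of z] by (simp add: ln_mult)
  then show ?thesis
    by (simp add: ce_loss_def a_def inner_diff_left inner_diff_right)
qed

text \<open>The same tangent-plane inequality with the endpoints exchanged, so the gradient sits at
  the new point.\<close>

lemma ce_loss_le_gradient: "ce_loss y z' - ce_loss y z \<le> (softmax z' - y) \<bullet> (z' - z)"
  using ce_loss_gradient_le[of z' y z] by (simp add: inner_diff_right)

lemma norm_softmax_diff_le: "norm y \<le> 1 \<Longrightarrow> norm (softmax z - y) \<le> 2"
  using norm_softmax_le[of z] norm_triangle_ineq4[of "softmax z" y] by linarith

lemma abs_softmax_diff_inner_le:
  assumes "norm y \<le> 1" "norm v \<le> C"
  shows "\<bar>(softmax z - y) \<bullet> v\<bar> \<le> 2 * C"
proof -
  have "\<bar>(softmax z - y) \<bullet> v\<bar> \<le> norm (softmax z - y) * norm v"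
    by (rule Cauchy_Schwarz_ineq2)
  also have "\<dots> \<le> 2 * C"
    using assms by (intro mult_mono norm_softmax_diff_le) auto
  finally show ?thesis .
qed

text \<open>Compare with the value at 0: the tangent planes at 0 and at \<open>z\<close> bound the
  increment from below and above, each by \<open>2 * C\<close>.\<close>

lemma abs_ce_loss_le:
  fixes z :: "real ^ 'v::finite"
  assumes "norm y \<le> 1" "norm z \<le> C"
  shows "\<bar>ce_loss y z\<bar> \<le> ln (real CARD('v)) + 2 * C"
proof -
  have "ce_loss y 0 = ln (real CARD('v))" by (simp add: ce_loss_def)
  moreover have "0 \<le> ln (real CARD('v))" by (simp add: Suc_leI)
  ultimately show ?thesis
    using ce_loss_gradient_le[of 0 y z] ce_loss_le_gradient[of y z 0]
      abs_softmax_diff_inner_le[OF assms, of 0] abs_softmax_diff_inner_le[OF assms, of z]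
    by (smt (verit) diff_zero inner_minus_right minus_diff_eq)
qed

subsection \<open>Measures on a closed set and supports\<close>

text \<open>A closed \<open>K\<close> is Borel, so having mass 1 on it amounts to almost sure
  membership.\<close>

lemma prob_measures_onD:
  assumes "\<rho> \<in> prob_measures_on K" "closed K"
  shows "prob_space \<rho>" "sets \<rho> = sets borel" "space \<rho> = UNIV" "AE x in \<rho>. x \<in> K"
proof -
  show s: "prob_space \<rho>" "sets \<rho> = sets borel"
    using assms by (auto simp: prob_measures_on_def)
  show "space \<rho> = UNIV" using sets_eq_imp_space_eq[OF s(2)] by simp
  interpret prob_space \<rho> by fact
  show "AE x in \<rho>. x \<in> K"
    using assms s(2) \<open>space \<rho> = UNIV\<close>
    by (subst AE_iff_emeasure_eq_1) (auto simp: prob_measures_on_def pred_def)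
qed

lemma prob_measures_onI:
  assumes "prob_space \<rho>" "sets \<rho> = sets borel" "closed K" "AE x in \<rho>. x \<in> K"
  shows "\<rho> \<in> prob_measures_on K"
proof -
  interpret prob_space \<rho> by fact
  have "Measurable.pred \<rho> (\<lambda>x. x \<in> K)"
    using assms(2,3) by (simp add: pred_def sets_eq_imp_space_eq[OF assms(2)])
  from AE_iff_emeasure_eq_1[OF this] have "emeasure \<rho> {x \<in> space \<rho>. x \<in> K} = 1"
    using assms(4) by simp
  then show ?thesis
    using assms sets_eq_imp_space_eq[OF assms(2)] by (auto simp: prob_measures_on_def)
qed

lemma integrable_prob_measures_on:
  fixes g :: "'a::topological_space \<Rightarrow> 'b::{banach, second_countable_topology}"
  assumes "\<rho> \<in> prob_measures_on K" "closed K" "g \<in> borel_measurable borel"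
    and "\<And>x. x \<in> K \<Longrightarrow> norm (g x) \<le> B"
  shows "integrable \<rho> g"
proof -
  interpret prob_space \<rho> using prob_measures_onD[OF assms(1,2)] by simp
  have "g \<in> borel_measurable \<rho>"
    using assms(3) prob_measures_onD(2)[OF assms(1,2)] by (simp cong: measurable_cong_sets)
  moreover have "AE x in \<rho>. norm (g x) \<le> B"
    using prob_measures_onD(4)[OF assms(1,2)] by eventually_elim (use assms(4) in auto)
  ultimately show ?thesis by (intro integrable_const_bound)
qed

text \<open>The complement of the support is the union of all open null sets. By second countability
  a countable subfamily has the same union, which is therefore null.\<close>

lemma AE_in_msupp:
  fixes \<rho> :: "'a::second_countable_topology measure"
  assumes "sets \<rho> = sets borel"
  shows "AE x in \<rho>. x \<in> msupp \<rho>"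
proof -
  define \<F> where "\<F> = {U. open U \<and> emeasure \<rho> U = 0}"
  obtain \<F>' where F: "\<F>' \<subseteq> \<F>" "countable \<F>'" "\<Union>\<F>' = \<Union>\<F>"
    using Lindelof[of \<F>] by (auto simp: \<F>_def)
  have "AE x in \<rho>. \<forall>U\<in>\<F>'. x \<notin> U"
    unfolding AE_ball_countable[OF F(2)]
    using F(1) assms by (auto simp: \<F>_def intro!: AE_not_in null_setsI)
  then show ?thesis
  proof eventually_elim
    case (elim x)
    then have "x \<notin> \<Union>\<F>" using F(3) by auto
    then show ?case by (auto simp: msupp_def \<F>_def zero_less_iff_neq_zero)
  qed
qed

lemma msupp_subset_closed:
  assumes "\<rho> \<in> prob_measures_on K" "closed K"
  shows "msupp \<rho> \<subseteq> K"
proof (rule ccontr)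
  assume "\<not> msupp \<rho> \<subseteq> K"
  then obtain x where "x \<in> msupp \<rho>" "x \<in> - K" by auto
  then have "emeasure \<rho> (- K) > 0" using assms(2) by (auto simp: msupp_def)
  moreover have "emeasure \<rho> (- K) = 0"
    using prob_measures_onD[OF assms] assms(2)
    by (subst AE_iff_measurable[symmetric, where P = "\<lambda>x. x \<in> K"]) auto
  ultimately show False by simp
qed

section \<open>Minimizers, means and supports\<close>

lemma is_arg_min_iff_le:
  fixes f :: "'a \<Rightarrow> 'b::linorder"
  shows "is_arg_min f P x \<longleftrightarrow> P x \<and> (\<forall>y. P y \<longrightarrow> f x \<le> f y)"
  by (auto simp: is_arg_min_def not_less)

text \<open>The deviation from the mean is nonnegative almost everywhere and integrates to
  zero.\<close>

lemma AE_eq_integral_of_ge: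
  fixes g :: "'a \<Rightarrow> real"
  assumes "prob_space \<rho>" "integrable \<rho> g" "AE x in \<rho>. (\<integral>x. g x \<partial>\<rho>) \<le> g x"
  shows "AE x in \<rho>. g x = (\<integral>x. g x \<partial>\<rho>)"
proof -
  interpret prob_space \<rho> by fact
  have "(\<integral>x. g x - (\<integral>x. g x \<partial>\<rho>) \<partial>\<rho>) = 0" using assms(2) by (simp add: prob_space)
  then have "AE x in \<rho>. g x - (\<integral>x. g x \<partial>\<rho>) = 0"
    using assms(2,3) by (subst (asm) integral_nonneg_eq_0_iff_AE) auto
  then show ?thesis by simp
qed

text \<open>Both sides say that the mean of \<open>g\<close> is its minimum over \<open>K\<close>.
  Forwards, \<open>g\<close> is almost surely at most each of its values on \<open>K\<close>,
  because the support has full mass. Backwards, \<open>g\<close> equals its mean almost everywhere,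
  and continuity carries this to every point of the support.\<close>

lemma msupp_subset_arg_min_iff:
  fixes g :: "'a::second_countable_topology \<Rightarrow> real"
  assumes \<rho>: "\<rho> \<in> prob_measures_on K" and K: "closed K"
    and g: "integrable \<rho> g" "continuous_on K g"
  shows "msupp \<rho> \<subseteq> {x. is_arg_min g (\<lambda>x. x \<in> K) x} \<longleftrightarrow> (\<forall>x\<in>K. (\<integral>x. g x \<partial>\<rho>) \<le> g x)"
    (is "?L \<longleftrightarrow> ?R")
proof
  interpret prob_space \<rho> using prob_measures_onD[OF \<rho> K] by simp
  assume L: ?L
  show ?R
  proof
    fix y assume y: "y \<in> K"
    have "AE x in \<rho>. g x \<le> g y"
      using AE_in_msupp[OF prob_measures_onD(2)[OF \<rho> K]]
      by eventually_elim (use L y in \<open>auto simp: is_arg_min_iff_le\<close>)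
    then show "(\<integral>x. g x \<partial>\<rho>) \<le> g y" by (intro integral_le_const g)
  qed
next
  assume R: ?R
  let ?m = "\<integral>x. g x \<partial>\<rho>"
  have ae: "AE x in \<rho>. g x = ?m"
    using prob_measures_onD(4)[OF \<rho> K] R
    by (intro AE_eq_integral_of_ge[OF prob_measures_onD(1)[OF \<rho> K] g(1)]) auto
  show ?L
  proof
    fix x assume x: "x \<in> msupp \<rho>"
    then have xK: "x \<in> K" using msupp_subset_closed[OF \<rho> K] by auto
    have "g x = ?m"
    proof (rule ccontr)
      assume "g x \<noteq> ?m"
      then have gx: "g x > ?m" using R xK by force
      \<comment> \<open>Continuity relative to \<open>K\<close> only gives a set open in
        \<open>K\<close>; \<open>U\<close> extends it to an open set of the whole space, as the
        definition of support demands.\<close>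
      obtain U where U: "open U" "U \<inter> K = g -` {?m<..} \<inter> K"
        using g(2) unfolding continuous_on_open_invariant by (metis open_greaterThan)
      have "emeasure \<rho> U > 0" using x U gx xK by (auto simp: msupp_def)
      moreover have "AE y in \<rho>. y \<notin> U"
        using ae prob_measures_onD(4)[OF \<rho> K] proof eventually_elim
        case (elim y)
        then have "y \<in> U \<longrightarrow> y \<in> g -` {?m<..}" using U(2) by blast
        then show ?case using elim by simp
      qed
      then have "emeasure \<rho> U = 0"
        using prob_measures_onD[OF \<rho> K] U(1)
        by (subst AE_iff_measurable[symmetric, where P = "\<lambda>x. x \<notin> U"]) auto
      ultimately show False by simp
    qed
    then show "x \<in> {x. is_arg_min g (\<lambda>x. x \<in> K) x}"
      using R xK by (auto simp: is_arg_min_iff_le)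
  qed
qed

text \<open>For \<open>t\<close> in [0,1] this is the mixture of \<rho> with weight
  \<open>1 - t\<close> and the point mass at \<open>x\<close> with weight \<open>t\<close>. It is
  encoded as the law of a two-stage draw: a biased coin chooses between \<open>x\<close> and a
  sample from \<rho>.\<close>

definition mix_return :: "real \<Rightarrow> 'a::topological_space measure \<Rightarrow> 'a \<Rightarrow> 'a measure" where
  "mix_return t \<rho> x = distr (measure_pmf (bernoulli_pmf t) \<Otimes>\<^sub>M \<rho>) borel (\<lambda>(b, y). if b then x else y)"

text \<open>Both facts are read off from the product of coin and sample: membership section by
  section, the integral by change of variables and Fubini, the coin contributing a two-term
  sum.\<close>

lemma
  fixes x :: "'a::second_countable_topology"
  assumes \<rho>: "\<rho> \<in> prob_measures_on K" and K: "closed K" and x: "x \<in> K"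
  shows mix_return_in_prob_measures_on: "mix_return t \<rho> x \<in> prob_measures_on K" (is ?P)
    and integral_mix_return: "t \<in> {0..1} \<Longrightarrow> integrable (mix_return t \<rho> x) g
      \<Longrightarrow> (\<integral>y. g y \<partial>mix_return t \<rho> x) = (1 - t) *\<^sub>R (\<integral>y. g y \<partial>\<rho>) + t *\<^sub>R (g x :: 'b::{banach, second_countable_topology})"
      (is "?T \<Longrightarrow> ?I \<Longrightarrow> ?E")
proof -
  interpret R: prob_space \<rho> using prob_measures_onD[OF \<rho> K] by simp
  interpret P: pair_prob_space "measure_pmf (bernoulli_pmf t)" \<rho> ..
  note [measurable_cong] = prob_measures_onD(2)[OF \<rho> K]
  let ?N = "measure_pmf (bernoulli_pmf t) \<Otimes>\<^sub>M \<rho>" and ?h = "\<lambda>(b, y). if b then x else y"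
  have h[measurable]: "?h \<in> measurable ?N borel" by measurable
  have [measurable]: "K \<in> sets borel" using K by simp
  have "AE p in ?N. ?h p \<in> K"
  proof (rule P.AE_pair_measure)
    show "AE b in measure_pmf (bernoulli_pmf t). AE y in \<rho>. ?h (b, y) \<in> K"
      using prob_measures_onD(4)[OF \<rho> K] x by auto
  qed measurable
  then show ?P
    unfolding mix_return_def
    by (intro prob_measures_onI K P.prob_space_distr) (auto simp: AE_distr_iff)
  assume t: ?T and g: ?I
  then have [measurable]: "g \<in> borel_measurable borel"
    unfolding mix_return_def by (auto dest: borel_measurable_integrable)
  have i: "integrable ?N (\<lambda>p. g (?h p))"
    using g by (simp add: mix_return_def integrable_distr_eq)
  have "(\<integral>y. g y \<partial>mix_return t \<rho> x) = (\<integral>p. g (?h p) \<partial>?N)"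
    by (simp add: mix_return_def integral_distr)
  also have "\<dots> = (\<integral>b. (\<integral>y. g (?h (b, y)) \<partial>\<rho>) \<partial>measure_pmf (bernoulli_pmf t))"
    by (rule P.integral_fst'[OF i, symmetric])
  also have "\<dots> = (1 - t) *\<^sub>R (\<integral>y. g y \<partial>\<rho>) + t *\<^sub>R g x"
    using t by (subst integral_measure_pmf[of UNIV]) (auto simp: UNIV_bool R.prob_space)
  finally show ?E .
qed

subsection \<open>Mean-field risk\<close>

text \<open>
  An abstract mean-field model: \<open>f l w x\<close> is the output at position \<open>l\<close> on sample \<open>w\<close> of a unit with
  parameter \<open>x\<close>, and \<open>y l w\<close> is the label.
\<close>

locale mean_field = prob_space M for M :: "'w measure" +
  fixes K :: "'a::{second_countable_topology, metric_space} set"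
    and f :: "'l::finite \<Rightarrow> 'w \<Rightarrow> 'a \<Rightarrow> real ^ 'v::finite"
    and y :: "'l \<Rightarrow> 'w \<Rightarrow> real ^ 'v"
    and B :: real
  assumes closed_K: "closed K"
    and measurable_f: "\<And>l. (\<lambda>(w, x). f l w x) \<in> borel_measurable (M \<Otimes>\<^sub>M borel)"
    and measurable_y[measurable]: "\<And>l. y l \<in> borel_measurable M"
    and continuous_f: "\<And>l w. continuous_on K (f l w)"
    and norm_f_le: "AE w in M. \<forall>l. \<forall>x\<in>K. norm (f l w x) \<le> B"
    and norm_y_le: "AE w in M. \<forall>l. norm (y l w) \<le> 1"
begin

definition out :: "'a measure \<Rightarrow> 'l \<Rightarrow> 'w \<Rightarrow> real ^ 'v" where
  "out \<rho> l w = (\<integral>x. f l w x \<partial>\<rho>)"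

definition pop_risk :: "'a measure \<Rightarrow> real" where
  "pop_risk \<rho> = (\<integral>w. (\<Sum>l\<in>UNIV. ce_loss (y l w) (out \<rho> l w)) / real CARD('l) \<partial>M)"

definition first_var :: "'a measure \<Rightarrow> 'a \<Rightarrow> real" where
  "first_var \<rho> x = (\<integral>w. (\<Sum>l\<in>UNIV. (softmax (out \<rho> l w) - y l w) \<bullet> f l w x) / real CARD('l) \<partial>M)"

section \<open>Measurability and bounds of the outputs\<close>

lemma measurable_f_compose[measurable (raw)]:
  assumes "g \<in> measurable N M" "h \<in> borel_measurable N"
  shows "(\<lambda>z. f l (g z) (h z)) \<in> borel_measurable N"
  using measurable_compose[OF measurable_Pair[OF assms] measurable_f[of l]] by simp

lemma measurable_out:
  assumes "\<rho> \<in> prob_measures_on K"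
  shows "out \<rho> l \<in> borel_measurable M"
proof -
  interpret R: prob_space \<rho> using prob_measures_onD[OF assms closed_K] by simp
  note [measurable_cong] = prob_measures_onD(2)[OF assms closed_K]
  have "(\<lambda>(w, x). f l w x) \<in> borel_measurable (M \<Otimes>\<^sub>M \<rho>)"
    using measurable_f by measurable
  then show ?thesis unfolding out_def by (rule R.borel_measurable_lebesgue_integral)
qed

lemma integrable_f:
  assumes "\<rho> \<in> prob_measures_on K" "w \<in> space M" "\<And>x. x \<in> K \<Longrightarrow> norm (f l w x) \<le> B"
  shows "integrable \<rho> (f l w)"
proof (rule integrable_prob_measures_on[OF assms(1) closed_K _ assms(3)])
  show "f l w \<in> borel_measurable borel"
    by (rule measurable_f_compose[of "\<lambda>_. w" borel "\<lambda>x. x"]) (use assms(2) in auto)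
qed

lemma norm_out_le:
  assumes \<rho>: "\<rho> \<in> prob_measures_on K" and w: "w \<in> space M" "\<And>x. x \<in> K \<Longrightarrow> norm (f l w x) \<le> B"
  shows "norm (out \<rho> l w) \<le> B"
proof -
  interpret R: prob_space \<rho> using prob_measures_onD[OF \<rho> closed_K] by simp
  have i: "integrable \<rho> (f l w)" by (rule integrable_f[OF assms])
  have "norm (out \<rho> l w) \<le> (\<integral>x. norm (f l w x) \<partial>\<rho>)"
    unfolding out_def by (rule integral_norm_bound)
  also have "\<dots> \<le> B"
    using i prob_measures_onD(4)[OF \<rho> closed_K] w(2) by (intro R.integral_le_const) auto
  finally show ?thesis .
qed

text \<open>Collects the exceptional null sets into one. Membership in \<open>space M\<close> is
  included because measurability of the section \<open>f l w\<close> requires it.\<close>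

lemma AE_good: "AE w in M. w \<in> space M \<and> (\<forall>l. \<forall>x\<in>K. norm (f l w x) \<le> B) \<and> (\<forall>l. norm (y l w) \<le> 1)"
  using AE_space norm_f_le norm_y_le by eventually_elim auto

lemma integrable_ce_loss:
  assumes \<rho>: "\<rho> \<in> prob_measures_on K"
  shows "integrable M (\<lambda>w. ce_loss (y l w) (out \<rho> l w))"
proof -
  note [measurable] = measurable_out[OF \<rho>]
  show ?thesis
  proof (rule integrable_const_bound)
    show "AE w in M. norm (ce_loss (y l w) (out \<rho> l w)) \<le> ln (real CARD('v)) + 2 * B"
      using AE_good by eventually_elim (auto intro!: abs_ce_loss_le norm_out_le \<rho>)
  qed measurable
qed

text \<open>The direction \<open>v\<close> is left arbitrary so that the lemma serves unit outputs,
  averaged outputs and their differences alike.\<close>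

lemma integrable_gradient:
  assumes \<rho>: "\<rho> \<in> prob_measures_on K" and [measurable]: "v \<in> borel_measurable M"
    and v: "AE w in M. norm (v w) \<le> C"
  shows "integrable M (\<lambda>w. (softmax (out \<rho> l w) - y l w) \<bullet> v w)"
proof -
  note [measurable] = measurable_out[OF \<rho>]
  show ?thesis
  proof (rule integrable_const_bound)
    show "AE w in M. norm ((softmax (out \<rho> l w) - y l w) \<bullet> v w) \<le> 2 * C"
      using AE_good v by eventually_elim (auto intro!: abs_softmax_diff_inner_le)
  qed measurable
qed

lemma AE_norm_out_le: "\<rho> \<in> prob_measures_on K \<Longrightarrow> AE w in M. norm (out \<rho> l w) \<le> B"
  using AE_good by eventually_elim (auto intro!: norm_out_le)

lemma AE_norm_f_le: "x \<in> K \<Longrightarrow> AE w in M. norm (f l w x) \<le> B"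
  using AE_good by eventually_elim auto

section \<open>Regularity of the first variation\<close>

lemma measurable_first_var:
  assumes "\<rho> \<in> prob_measures_on K"
  shows "first_var \<rho> \<in> borel_measurable borel"
proof -
  note [measurable] = measurable_out[OF assms]
  show ?thesis unfolding first_var_def by measurable
qed

lemma abs_first_var_le:
  assumes \<rho>: "\<rho> \<in> prob_measures_on K" and x: "x \<in> K"
  shows "\<bar>first_var \<rho> x\<bar> \<le> 2 * B"
proof -
  note [measurable] = measurable_out[OF \<rho>]
  have "\<bar>first_var \<rho> x\<bar> \<le> (\<integral>w. \<bar>(\<Sum>l\<in>UNIV. (softmax (out \<rho> l w) - y l w) \<bullet> f l w x) / real CARD('l)\<bar> \<partial>M)"
    unfolding first_var_def by (rule integral_abs_bound)
  also have "\<dots> \<le> 2 * B"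
  proof (rule integral_le_const)
    show "integrable M (\<lambda>w. \<bar>(\<Sum>l\<in>UNIV. (softmax (out \<rho> l w) - y l w) \<bullet> f l w x) / real CARD('l)\<bar>)"
      by (intro integrable_abs integrable_divide Bochner_Integration.integrable_sum integrable_gradient[OF \<rho> _ AE_norm_f_le[OF x]])
        measurable
    show "AE w in M. \<bar>(\<Sum>l\<in>UNIV. (softmax (out \<rho> l w) - y l w) \<bullet> f l w x) / real CARD('l)\<bar> \<le> 2 * B"
      using AE_good
    proof eventually_elim
      case (elim w)
      have "\<bar>\<Sum>l\<in>UNIV. (softmax (out \<rho> l w) - y l w) \<bullet> f l w x\<bar> \<le> (\<Sum>l\<in>(UNIV :: 'l set). 2 * B)"
        using elim x by (intro order_trans[OF sum_abs] sum_mono abs_softmax_diff_inner_le) auto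
      then show ?case by (simp add: field_simps)
    qed
  qed
  finally show ?thesis .
qed

lemma integrable_first_var:
  assumes "\<rho> \<in> prob_measures_on K" "\<nu> \<in> prob_measures_on K"
  shows "integrable \<nu> (first_var \<rho>)"
  using assms abs_first_var_le[OF assms(1)]
  by (intro integrable_prob_measures_on[OF assms(2) closed_K, where B = "2 * B"] measurable_first_var) auto

text \<open>Dominated convergence along sequences, which suffice in a metric space: the integrand
  converges by continuity of \<open>f l w\<close> on \<open>K\<close> and is bounded by a
  constant.\<close>

lemma continuous_first_var:
  assumes \<rho>: "\<rho> \<in> prob_measures_on K"
  shows "continuous_on K (first_var \<rho>)"
proof (unfold continuous_on_sequentially, intro allI ballI impI)
  note [measurable] = measurable_out[OF \<rho>]
  fix u x assume x: "x \<in> K" and u: "(\<forall>n. u n \<in> K) \<and> u \<longlonglongrightarrow> x"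
  show "(first_var \<rho> \<circ> u) \<longlonglongrightarrow> first_var \<rho> x"
    unfolding first_var_def comp_def
  proof (rule integral_dominated_convergence[where w = "\<lambda>_. (\<Sum>l\<in>(UNIV::'l set). 2 * B) / real CARD('l)"])
    show "AE w in M. (\<lambda>n. (\<Sum>l\<in>UNIV. (softmax (out \<rho> l w) - y l w) \<bullet> f l w (u n)) / real CARD('l))
        \<longlonglongrightarrow> (\<Sum>l\<in>UNIV. (softmax (out \<rho> l w) - y l w) \<bullet> f l w x) / real CARD('l)"
    proof (intro AE_I2 tendsto_intros)
      fix w l show "(\<lambda>n. f l w (u n)) \<longlonglongrightarrow> f l w x"
        using u x by (intro continuous_on_tendsto_compose[OF continuous_f]) auto
    qed auto
    show "AE w in M. norm ((\<Sum>l\<in>UNIV. (softmax (out \<rho> l w) - y l w) \<bullet> f l w (u n)) / real CARD('l))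
        \<le> (\<Sum>l\<in>(UNIV::'l set). 2 * B) / real CARD('l)" for n
      using AE_good
    proof eventually_elim
      case (elim w)
      show ?case
        unfolding real_norm_def abs_divide abs_of_nat
        using elim u
        by (intro divide_right_mono order_trans[OF sum_abs] sum_mono abs_softmax_diff_inner_le) auto
    qed
  qed (auto intro!: borel_measurable_divide borel_measurable_sum borel_measurable_inner)
qed

text \<open>By Fubini the \<nu>-integral moves inside; the pairing is linear in
  \<open>f l w x\<close>, whose \<nu>-average is \<open>out \<nu> l w\<close>.\<close>

lemma integral_first_var:
  assumes \<rho>: "\<rho> \<in> prob_measures_on K" and \<nu>: "\<nu> \<in> prob_measures_on K"
  shows "(\<integral>x. first_var \<rho> x \<partial>\<nu>)
    = (\<integral>w. (\<Sum>l\<in>UNIV. (softmax (out \<rho> l w) - y l w) \<bullet> out \<nu> l w) / real CARD('l) \<partial>M)"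
proof -
  interpret N: prob_space \<nu> using prob_measures_onD[OF \<nu> closed_K] by simp
  interpret P: pair_prob_space M \<nu> ..
  note [measurable_cong] = prob_measures_onD(2)[OF \<nu> closed_K]
  note [measurable] = measurable_out[OF \<rho>] measurable_out[OF \<nu>]
  let ?g = "\<lambda>l w x. (softmax (out \<rho> l w) - y l w) \<bullet> f l w x"
  \<comment> \<open>The bound holds only for almost every \<open>w\<close> and for \<open>x\<close>
    in \<open>K\<close>, so it is lifted to the product measure through its sections.\<close>
  have int: "integrable (M \<Otimes>\<^sub>M \<nu>) (\<lambda>p. ?g l (fst p) (snd p))" for l
  proof (rule P.P.integrable_const_bound)
    show "AE p in M \<Otimes>\<^sub>M \<nu>. norm (?g l (fst p) (snd p)) \<le> 2 * B"
    proof (rule P.AE_pair_measure)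
      show "AE w in M. AE x in \<nu>. norm (?g l (fst (w, x)) (snd (w, x))) \<le> 2 * B"
        using AE_good
      proof eventually_elim
        case (elim w)
        show ?case using prob_measures_onD(4)[OF \<nu> closed_K]
          by eventually_elim (use elim in \<open>auto intro!: abs_softmax_diff_inner_le\<close>)
      qed
    qed measurable
  qed measurable
  have "integrable (M \<Otimes>\<^sub>M \<nu>) (\<lambda>(w, x). (\<Sum>l\<in>UNIV. ?g l w x) / real CARD('l))"
    unfolding case_prod_beta by (intro integrable_divide Bochner_Integration.integrable_sum int)
  from P.Fubini_integral[OF this]
  have "(\<integral>x. first_var \<rho> x \<partial>\<nu>) = (\<integral>w. (\<integral>x. (\<Sum>l\<in>UNIV. ?g l w x) / real CARD('l) \<partial>\<nu>) \<partial>M)"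
    unfolding first_var_def .
  also have "\<dots> = (\<integral>w. (\<Sum>l\<in>UNIV. (softmax (out \<rho> l w) - y l w) \<bullet> out \<nu> l w) / real CARD('l) \<partial>M)"
  proof (rule integral_cong_AE)
    show "AE w in M. (\<integral>x. (\<Sum>l\<in>UNIV. ?g l w x) / real CARD('l) \<partial>\<nu>)
        = (\<Sum>l\<in>UNIV. (softmax (out \<rho> l w) - y l w) \<bullet> out \<nu> l w) / real CARD('l)"
      using AE_good
    proof eventually_elim
      case (elim w)
      have "integrable \<nu> (f l w)" for l using elim by (intro integrable_f[OF \<nu>]) auto
      then show ?case by (simp add: out_def)
    qed
  qed measurable
  finally show ?thesis .
qed

text \<open>Linearity of the directional derivative in its direction. With \<open>v\<close> and
  \<open>v'\<close> abstract it covers the comparison of two measures as well as that of a point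
  with a measure.\<close>

lemma first_var_diff_eq:
  assumes \<rho>: "\<rho> \<in> prob_measures_on K"
    and v[measurable]: "\<And>l. v l \<in> borel_measurable M" "\<And>l. v' l \<in> borel_measurable M"
    and "\<And>l. AE w in M. norm (v l w) \<le> B" "\<And>l. AE w in M. norm (v' l w) \<le> B"
  shows "(\<integral>w. (\<Sum>l\<in>UNIV. (softmax (out \<rho> l w) - y l w) \<bullet> v l w) / real CARD('l) \<partial>M)
      - (\<integral>w. (\<Sum>l\<in>UNIV. (softmax (out \<rho> l w) - y l w) \<bullet> v' l w) / real CARD('l) \<partial>M)
    = (\<integral>w. (\<Sum>l\<in>UNIV. (softmax (out \<rho> l w) - y l w) \<bullet> (v l w - v' l w)) / real CARD('l) \<partial>M)"
proof -
  have "integrable M (\<lambda>w. (\<Sum>l\<in>UNIV. (softmax (out \<rho> l w) - y l w) \<bullet> v l w) / real CARD('l))"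
    "integrable M (\<lambda>w. (\<Sum>l\<in>UNIV. (softmax (out \<rho> l w) - y l w) \<bullet> v' l w) / real CARD('l))"
    using assms by (auto intro!: integrable_divide Bochner_Integration.integrable_sum integrable_gradient)
  from Bochner_Integration.integral_diff[OF this, symmetric] show ?thesis
    by (simp add: inner_diff_right sum_subtractf diff_divide_distrib)
qed

section \<open>Convexity bounds for risk increments\<close>

lemma pop_risk_diff:
  assumes "\<rho> \<in> prob_measures_on K" "\<nu> \<in> prob_measures_on K"
  shows "pop_risk \<nu> - pop_risk \<rho>
    = (\<integral>w. (\<Sum>l\<in>UNIV. ce_loss (y l w) (out \<nu> l w) - ce_loss (y l w) (out \<rho> l w)) / real CARD('l) \<partial>M)"
  using assms unfolding pop_risk_def
  by (subst Bochner_Integration.integral_diff[symmetric])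
    (auto intro!: integrable_divide Bochner_Integration.integrable_sum integrable_ce_loss simp: sum_subtractf diff_divide_distrib)

lemma AE_norm_out_diff_le:
  assumes "\<rho> \<in> prob_measures_on K" "\<nu> \<in> prob_measures_on K"
  shows "AE w in M. norm (out \<nu> l w - out \<rho> l w) \<le> 2 * B"
  using AE_norm_out_le[OF assms(1), of l] AE_norm_out_le[OF assms(2), of l]
  by eventually_elim (use norm_triangle_ineq4 in \<open>smt (verit)\<close>)

text \<open>First-order convexity: by Fubini the left side is the integrated gradient at
  \<open>out \<rho>\<close> paired with \<open>out \<nu> - out \<rho>\<close>, and the tangent plane
  lies below the loss pointwise.\<close>

lemma first_var_le_pop_risk_diff:
  assumes \<rho>: "\<rho> \<in> prob_measures_on K" and \<nu>: "\<nu> \<in> prob_measures_on K"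
  shows "(\<integral>x. first_var \<rho> x \<partial>\<nu>) - (\<integral>x. first_var \<rho> x \<partial>\<rho>) \<le> pop_risk \<nu> - pop_risk \<rho>"
proof -
  note [measurable] = measurable_out[OF \<rho>] measurable_out[OF \<nu>]
  have "(\<integral>x. first_var \<rho> x \<partial>\<nu>) - (\<integral>x. first_var \<rho> x \<partial>\<rho>)
    = (\<integral>w. (\<Sum>l\<in>UNIV. (softmax (out \<rho> l w) - y l w) \<bullet> (out \<nu> l w - out \<rho> l w)) / real CARD('l) \<partial>M)"
    unfolding integral_first_var[OF \<rho> \<rho>] integral_first_var[OF \<rho> \<nu>]
    by (intro first_var_diff_eq AE_norm_out_le \<rho> \<nu>) measurable
  also have "\<dots> \<le> pop_risk \<nu> - pop_risk \<rho>"
    unfolding pop_risk_diff[OF \<rho> \<nu>]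
  proof (rule integral_mono)
    show "integrable M (\<lambda>w. (\<Sum>l\<in>UNIV. (softmax (out \<rho> l w) - y l w) \<bullet> (out \<nu> l w - out \<rho> l w)) / real CARD('l))"
      by (intro integrable_divide Bochner_Integration.integrable_sum integrable_gradient[OF \<rho> _ AE_norm_out_diff_le[OF \<rho> \<nu>]])
        measurable
  qed (auto intro!: divide_right_mono sum_mono ce_loss_gradient_le integrable_divide
      Bochner_Integration.integrable_sum Bochner_Integration.integrable_diff integrable_ce_loss \<rho> \<nu>)
  finally show ?thesis .
qed

text \<open>Convexity with the gradient at the endpoint \<nu> bounds the increment from above, which
  is the direction needed to exploit minimality.\<close>

lemma pop_risk_diff_le:
  assumes \<rho>: "\<rho> \<in> prob_measures_on K" and \<nu>: "\<nu> \<in> prob_measures_on K"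
  shows "pop_risk \<nu> - pop_risk \<rho>
    \<le> (\<integral>w. (\<Sum>l\<in>UNIV. (softmax (out \<nu> l w) - y l w) \<bullet> (out \<nu> l w - out \<rho> l w)) / real CARD('l) \<partial>M)"
  unfolding pop_risk_diff[OF \<rho> \<nu>]
proof (rule integral_mono)
  show "integrable M (\<lambda>w. (\<Sum>l\<in>UNIV. (softmax (out \<nu> l w) - y l w) \<bullet> (out \<nu> l w - out \<rho> l w)) / real CARD('l))"
    by (intro integrable_divide Bochner_Integration.integrable_sum integrable_gradient[OF \<nu> _ AE_norm_out_diff_le[OF \<rho> \<nu>]])
      (intro borel_measurable_diff measurable_out \<rho> \<nu>)
qed (auto intro!: divide_right_mono sum_mono ce_loss_le_gradient integrable_divide
    Bochner_Integration.integrable_sum Bochner_Integration.integrable_diff integrable_ce_loss \<rho> \<nu>)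

section \<open>Perturbation towards a point mass\<close>

lemma out_mix_return:
  assumes \<rho>: "\<rho> \<in> prob_measures_on K" and x: "x \<in> K" and t: "t \<in> {0..1}"
    and w: "w \<in> space M" "\<And>x. x \<in> K \<Longrightarrow> norm (f l w x) \<le> B"
  shows "out (mix_return t \<rho> x) l w = out \<rho> l w + t *\<^sub>R (f l w x - out \<rho> l w)"
proof -
  have "integrable (mix_return t \<rho> x) (f l w)"
    by (intro integrable_f mix_return_in_prob_measures_on[OF \<rho> closed_K x] w)
  from integral_mix_return[OF \<rho> closed_K x t this] show ?thesis
    unfolding out_def by (simp add: algebra_simps)
qed

text \<open>
  Moving mass \<open>t\<close> to the point \<open>x\<close> cannot decrease the risk of a minimizer.  By convexity of the loss,
  the increment is at most \<open>t\<close> times an integral that converges to the directional derivative as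
  \<open>t \<rightarrow> 0\<close>, so that no second-order bound is needed.
\<close>

lemma first_var_ge_of_minimizer:
  assumes \<rho>: "\<rho> \<in> prob_measures_on K"
    and min: "\<And>\<nu>. \<nu> \<in> prob_measures_on K \<Longrightarrow> pop_risk \<rho> \<le> pop_risk \<nu>"
    and x: "x \<in> K"
  shows "(\<integral>x. first_var \<rho> x \<partial>\<rho>) \<le> first_var \<rho> x"
proof -
  \<comment> \<open>A null sequence in (0,1]; the successor keeps the denominator positive at
    \<open>n = 0\<close>.\<close>
  define t where "t n = 1 / real (Suc n)" for n
  have t: "t n \<in> {0..1}" "t n > 0" for n by (auto simp: t_def)
  have t_lim: "t \<longlonglongrightarrow> 0" unfolding t_def using LIMSEQ_Suc[OF lim_1_over_n] by simp
  define \<nu> where "\<nu> n = mix_return (t n) \<rho> x" for n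
  have \<nu>: "\<nu> n \<in> prob_measures_on K" for n
    unfolding \<nu>_def by (rule mix_return_in_prob_measures_on[OF \<rho> closed_K x])
  note [measurable] = measurable_out[OF \<rho>] measurable_out[OF \<nu>]
  define d where "d l w = f l w x - out \<rho> l w" for l w
  have d[measurable]: "d l \<in> borel_measurable M" for l unfolding d_def by measurable
  have norm_d: "AE w in M. norm (d l w) \<le> 2 * B" for l
    unfolding d_def using AE_norm_out_le[OF \<rho>, of l] AE_norm_f_le[OF x, of l]
    by eventually_elim (use norm_triangle_ineq4 in \<open>smt (verit)\<close>)
  \<comment> \<open>One null set serves all \<open>n\<close> and \<open>l\<close>: the affine
    formula for the mixture holds wherever the bounds in \<open>AE_good\<close> do.\<close>
  have AE_good_d: "AE w in M. (\<forall>l. norm (y l w) \<le> 1) \<and> (\<forall>l. norm (d l w) \<le> 2 * B)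
      \<and> (\<forall>n l. out (\<nu> n) l w = out \<rho> l w + t n *\<^sub>R d l w)"
    using AE_good AE_all_countable[THEN iffD2, OF allI, OF norm_d]
    by eventually_elim (auto simp: \<nu>_def d_def intro!: out_mix_return[OF \<rho> x t(1)])
  let ?I = "\<lambda>\<nu>. \<integral>w. (\<Sum>l\<in>UNIV. (softmax (out \<nu> l w) - y l w) \<bullet> d l w) / real CARD('l) \<partial>M"
  \<comment> \<open>Minimality makes the increment nonnegative, and its upper bound is
    \<open>t n\<close> times this integral; dividing by \<open>t n > 0\<close> leaves the
    sign.\<close>
  have nonneg: "0 \<le> ?I (\<nu> n)" for n
  proof -
    have "0 \<le> pop_risk (\<nu> n) - pop_risk \<rho>" using min[OF \<nu>] by simp
    also have "\<dots> \<le> (\<integral>w. (\<Sum>l\<in>UNIV. (softmax (out (\<nu> n) l w) - y l w) \<bullet> (out (\<nu> n) l w - out \<rho> l w)) / real CARD('l) \<partial>M)"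
      by (rule pop_risk_diff_le[OF \<rho> \<nu>])
    also have "\<dots> = (\<integral>w. t n * ((\<Sum>l\<in>UNIV. (softmax (out (\<nu> n) l w) - y l w) \<bullet> d l w) / real CARD('l)) \<partial>M)"
    proof (rule integral_cong_AE)
      show "AE w in M. (\<Sum>l\<in>UNIV. (softmax (out (\<nu> n) l w) - y l w) \<bullet> (out (\<nu> n) l w - out \<rho> l w)) / real CARD('l)
        = t n * ((\<Sum>l\<in>UNIV. (softmax (out (\<nu> n) l w) - y l w) \<bullet> d l w) / real CARD('l))"
        using AE_good_d
      proof eventually_elim
        case (elim w)
        then have e: "out (\<nu> n) l w - out \<rho> l w = t n *\<^sub>R d l w" for l by simp
        show ?case unfolding e by (simp add: sum_distrib_left)
      qed
    qed measurable
    also have "\<dots> = t n * ?I (\<nu> n)" by simp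
    finally show ?thesis using t(2)[of n] unfolding zero_le_mult_iff by linarith
  qed
  have "(\<lambda>n. ?I (\<nu> n)) \<longlonglongrightarrow> ?I \<rho>"
  \<comment> \<open>In the dominating constant, one factor 2 bounds softmax minus label and
    \<open>2 * B\<close> bounds the direction \<open>d\<close>.\<close>
  proof (rule integral_dominated_convergence[where w = "\<lambda>_. (\<Sum>l\<in>(UNIV::'l set). 2 * (2 * B)) / real CARD('l)"])
    show "AE w in M. (\<lambda>n. (\<Sum>l\<in>UNIV. (softmax (out (\<nu> n) l w) - y l w) \<bullet> d l w) / real CARD('l))
        \<longlonglongrightarrow> (\<Sum>l\<in>UNIV. (softmax (out \<rho> l w) - y l w) \<bullet> d l w) / real CARD('l)"
      using AE_good_d
    proof eventually_elim
      case (elim w)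
      have "(\<lambda>n. softmax (out (\<nu> n) l w)) \<longlonglongrightarrow> softmax (out \<rho> l w)" for l
      proof (rule continuous_on_tendsto_compose[OF continuous_on_softmax[of UNIV]])
        have "(\<lambda>n. out \<rho> l w + t n *\<^sub>R d l w) \<longlonglongrightarrow> out \<rho> l w + 0 *\<^sub>R d l w"
          by (intro tendsto_intros t_lim)
        then show "(\<lambda>n. out (\<nu> n) l w) \<longlonglongrightarrow> out \<rho> l w" using elim by simp
      qed auto
      then show ?case by (intro tendsto_intros) auto
    qed
    show "AE w in M. norm ((\<Sum>l\<in>UNIV. (softmax (out (\<nu> n) l w) - y l w) \<bullet> d l w) / real CARD('l))
        \<le> (\<Sum>l\<in>(UNIV::'l set). 2 * (2 * B)) / real CARD('l)" for n
      using AE_good_d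
    proof eventually_elim
      case (elim w)
      show ?case
        unfolding real_norm_def abs_divide abs_of_nat
        using elim
        by (intro divide_right_mono order_trans[OF sum_abs] sum_mono abs_softmax_diff_inner_le) auto
    qed
  qed (auto intro!: borel_measurable_divide borel_measurable_sum borel_measurable_inner)
  then have "0 \<le> ?I \<rho>" by (rule LIMSEQ_le_const) (use nonneg in auto)
  \<comment> \<open>The limit is the derivative in direction
    \<open>f l w x - out \<rho> l w\<close>; linearity splits it into the value at \<open>x\<close>
    and the \<rho>-mean.\<close>
  also have "?I \<rho> = first_var \<rho> x - (\<integral>x. first_var \<rho> x \<partial>\<rho>)"
    unfolding integral_first_var[OF \<rho> \<rho>] unfolding d_def first_var_def
    by (intro first_var_diff_eq[symmetric] AE_norm_out_le AE_norm_f_le \<rho> x) measurable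
  finally show ?thesis by simp
qed

section \<open>Optimality conditions\<close>

lemma minimizer_iff:
  assumes \<rho>: "\<rho> \<in> prob_measures_on K"
  shows "is_arg_min pop_risk (\<lambda>\<rho>. \<rho> \<in> prob_measures_on K) \<rho>
    \<longleftrightarrow> (\<forall>x\<in>K. (\<integral>x. first_var \<rho> x \<partial>\<rho>) \<le> first_var \<rho> x)" (is "?L \<longleftrightarrow> ?R")
proof
  assume ?L
  then show ?R using first_var_ge_of_minimizer[OF \<rho>] by (auto simp: is_arg_min_iff_le)
next
  assume R: ?R
  have "pop_risk \<rho> \<le> pop_risk \<nu>" if \<nu>: "\<nu> \<in> prob_measures_on K" for \<nu>
  proof -
    interpret N: prob_space \<nu> using prob_measures_onD[OF \<nu> closed_K] by simp
    \<comment> \<open>Integrate the pointwise bound against \<nu>, which is concentrated on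
      \<open>K\<close>; the convexity inequality then compares the risks.\<close>
    have "(\<integral>x. first_var \<rho> x \<partial>\<rho>) \<le> (\<integral>x. first_var \<rho> x \<partial>\<nu>)"
      using prob_measures_onD(4)[OF \<nu> closed_K] R
      by (intro N.integral_ge_const integrable_first_var \<rho> \<nu>) auto
    with first_var_le_pop_risk_diff[OF \<rho> \<nu>] show ?thesis by simp
  qed
  then show ?L using \<rho> by (simp add: is_arg_min_iff_le)
qed

theorem minimizer_iff_msupp:
  assumes \<rho>: "\<rho> \<in> prob_measures_on K"
  shows "is_arg_min pop_risk (\<lambda>\<rho>. \<rho> \<in> prob_measures_on K) \<rho>
    \<longleftrightarrow> msupp \<rho> \<subseteq> {x. is_arg_min (first_var \<rho>) (\<lambda>x. x \<in> K) x}"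
  using minimizer_iff[OF \<rho>]
    msupp_subset_arg_min_iff[OF \<rho> closed_K integrable_first_var[OF \<rho> \<rho>] continuous_first_var[OF \<rho>]]
  by simp

text \<open>The almost sure equality comes from the inequality itself: a function almost surely at
  least its mean equals it almost everywhere.\<close>

theorem minimizer_iff_AE:
  assumes \<rho>: "\<rho> \<in> prob_measures_on K"
  shows "is_arg_min pop_risk (\<lambda>\<rho>. \<rho> \<in> prob_measures_on K) \<rho>
    \<longleftrightarrow> (\<forall>x\<in>K. (\<integral>x. first_var \<rho> x \<partial>\<rho>) \<le> first_var \<rho> x)
      \<and> (AE x in \<rho>. first_var \<rho> x = (\<integral>x. first_var \<rho> x \<partial>\<rho>))"
proof -
  have "AE x in \<rho>. first_var \<rho> x = (\<integral>x. first_var \<rho> x \<partial>\<rho>)"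
    if "\<forall>x\<in>K. (\<integral>x. first_var \<rho> x \<partial>\<rho>) \<le> first_var \<rho> x"
    using prob_measures_onD(4)[OF \<rho> closed_K] that
    by (intro AE_eq_integral_of_ge[OF prob_measures_onD(1)[OF \<rho> closed_K] integrable_first_var[OF \<rho> \<rho>]]) auto
  then show ?thesis using minimizer_iff[OF \<rho>] by auto
qed

end

subsection \<open>Attention\<close>

lemma continuous_on_matrix_mult[continuous_intros]:
  fixes F :: "'z::topological_space \<Rightarrow> real ^ 'n::finite ^ 'm::finite" and G :: "'z \<Rightarrow> real ^ 'p::finite ^ 'n"
  assumes "continuous_on S F" "continuous_on S G"
  shows "continuous_on S (\<lambda>z. F z ** G z)"
  unfolding matrix_matrix_mult_def by (intro continuous_intros assms)

lemma continuous_on_transpose[continuous_intros]: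
  fixes F :: "'z::topological_space \<Rightarrow> real ^ 'n::finite ^ 'm::finite"
  assumes "continuous_on S F"
  shows "continuous_on S (\<lambda>z. transpose (F z))"
  unfolding transpose_def by (intro continuous_intros assms)

lemma continuous_on_attn_score[continuous_intros]:
  fixes Q :: "'z::topological_space \<Rightarrow> real ^ 'k::finite ^ 'x::finite" and X :: "'z \<Rightarrow> real ^ 'x ^ 'l::finite"
  assumes "continuous_on S Q" "continuous_on S R" "continuous_on S X"
  shows "continuous_on S (\<lambda>z. attn_score (Q z) (R z) (X z))"
  unfolding attn_score_def by (intro continuous_intros assms)

lemma continuous_on_attention:
  "continuous_on S (\<lambda>(X :: real ^ 'x ^ ('l::{finite,linorder}), \<omega> :: ('x::finite, 'k::finite) head).
     attention \<omega> X)"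
proof -
  have "continuous_on S (\<lambda>(X :: real ^ 'x ^ ('l::{finite,linorder}), \<omega> :: ('x, 'k) head). if s \<le> r
        then exp (attn_score (fst \<omega>) (fst (snd \<omega>)) X $ r $ s / sqrt (real CARD('k))) /
             (\<Sum>s' | s' \<le> r. exp (attn_score (fst \<omega>) (fst (snd \<omega>)) X $ r $ s' / sqrt (real CARD('k))))
        else 0)" for r s :: 'l
  proof (cases "s \<le> r")
    case True
    \<comment> \<open>The unmasked positions of row \<open>r\<close> include \<open>s\<close>, so
      the normalizing sum is nonempty and positive.\<close>
    have "(\<Sum>s' | s' \<le> r. exp (g s')) \<noteq> 0" for g :: "'l \<Rightarrow> real"
    proof -
      have "0 < (\<Sum>s' | s' \<le> r. exp (g s'))" using True by (intro sum_pos) auto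
      then show ?thesis by simp
    qed
    then show ?thesis using True
      by (auto simp: case_prod_beta intro!: continuous_intros)
  qed simp
  then show ?thesis
    unfolding attention_def case_prod_beta by (intro continuous_on_vec_lambda)
qed

text \<open>Joint continuity yields both joint measurability in sample and parameter and continuity
  in the parameter alone.\<close>

lemma continuous_on_psi: "continuous_on S (\<lambda>(X, \<omega>). psi Wout l X \<omega>)"
  unfolding psi_def case_prod_beta
  by (intro continuous_intros continuous_on_attention[unfolded case_prod_beta])

theorem theorem4p3:
  fixes M :: "'w measure"
    and X :: "'w \<Rightarrow> real ^ 'x::finite ^ ('l::{finite,linorder})"
    and Y :: "'l::{finite,linorder} \<Rightarrow> real ^ 'x ^ ('l::{finite,linorder}) \<Rightarrow> real ^ 'v::finite"
    and Wout :: "real ^ 'v ^ 'x"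
    and K :: "('x, 'k::finite) head set"
    and Kx :: "(real ^ 'x) set"
    and B :: real
    and \<rho>s :: "('x, 'k) head measure"
  assumes "prob_space M"
    and "X \<in> borel_measurable M"
    and "\<And>l. (\<lambda>w. Y l (X w)) \<in> borel_measurable M"
    and "AE w in M. \<forall>l. one_hot (Y l (X w))"
    and "compact K" and "compact Kx"
    and "AE w in M. X w \<in> inputs_in Kx"
    and "AE w in M. \<forall>l. C3_on (psi Wout l (X w) :: ('x, 'k) head \<Rightarrow> real ^ 'v) K"
    and "\<And>(x :: real ^ 'x ^ ('l::{finite,linorder})) l \<omega>. x \<in> inputs_in Kx \<Longrightarrow> \<omega> \<in> K \<Longrightarrow>
           norm (psi Wout l x \<omega>) + norm (nabla (psi Wout l x) \<omega>)
           + norm (nabla (nabla (psi Wout l x)) \<omega>)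
           + norm (nabla (nabla (nabla (psi Wout l x))) \<omega>) \<le> B"
    and "\<rho>s \<in> prob_measures_on K"
  shows "(is_arg_min (risk M X Y Wout) (\<lambda>\<rho>. \<rho> \<in> prob_measures_on K) \<rho>s \<longleftrightarrow>
            msupp \<rho>s \<subseteq> {\<omega>. is_arg_min (\<lambda>\<omega>. first_variation M X Y Wout \<omega> \<rho>s) (\<lambda>\<omega>. \<omega> \<in> K) \<omega>})
       \<and> (is_arg_min (risk M X Y Wout) (\<lambda>\<rho>. \<rho> \<in> prob_measures_on K) \<rho>s \<longleftrightarrow>
            (\<forall>\<omega>\<in>K. first_variation M X Y Wout \<omega> \<rho>s
                      \<ge> (\<integral>\<omega>'. first_variation M X Y Wout \<omega>' \<rho>s \<partial>\<rho>s))
            \<and> (AE \<omega> in \<rho>s. first_variation M X Y Wout \<omega> \<rho>s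
                      = (\<integral>\<omega>'. first_variation M X Y Wout \<omega>' \<rho>s \<partial>\<rho>s)))"
proof -
  interpret mf: mean_field M K "\<lambda>l w. psi Wout l (X w)" "\<lambda>l w. Y l (X w)" B
  proof (intro mean_field.intro mean_field_axioms.intro)
    show "closed K" using assms(5) by (rule compact_imp_closed)
    show "(\<lambda>(w, x). psi Wout l (X w) x) \<in> borel_measurable (M \<Otimes>\<^sub>M borel)" for l
    proof -
      \<comment> \<open>Input and parameter spaces are second countable, so the product of their
        Borel sigma-algebras is the Borel sigma-algebra of the product.\<close>
      have 1: "(\<lambda>(x, \<omega>). psi Wout l x \<omega>) \<in> borel_measurable (borel \<Otimes>\<^sub>M borel)"
        unfolding borel_prod by (intro borel_measurable_continuous_onI continuous_on_psi)
      have 2: "(\<lambda>(w, \<omega>). (X w, \<omega>)) \<in> measurable (M \<Otimes>\<^sub>M borel) (borel \<Otimes>\<^sub>M borel)"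
        using assms(2) by measurable
      show ?thesis using measurable_compose[OF 2 1] by (simp add: case_prod_beta')
    qed
    show "continuous_on K (psi Wout l (X w))" for l w
      using continuous_on_compose2[OF continuous_on_psi[of UNIV Wout l], of K "\<lambda>\<omega>. (X w, \<omega>)"]
      by (simp add: continuous_intros)
    \<comment> \<open>The derivative norms are nonnegative, so the first summand of the assumed
      bound is itself at most \<open>B\<close>.\<close>
    have bound: "norm (psi Wout l x \<omega>) \<le> B" if "x \<in> inputs_in Kx" "\<omega> \<in> K"
      for x :: "real ^ 'x ^ ('l::{finite,linorder})" and l \<omega>
      using assms(9)[OF that, of l] by (smt (verit) norm_ge_zero)
    show "AE w in M. \<forall>l. \<forall>\<omega>\<in>K. norm (psi Wout l (X w) \<omega>) \<le> B"
      using assms(7) by eventually_elim (auto intro: bound)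
    show "AE w in M. \<forall>l. norm (Y l (X w)) \<le> 1"
      using assms(4) by eventually_elim (auto simp: one_hot_def, metis norm_axis_1 order_refl)
  qed (fact assms)+
  have risk: "risk M X Y Wout = mf.pop_risk"
    by (simp add: fun_eq_iff risk_def mf.pop_risk_def mf.out_def logit_def)
  have var: "first_variation M X Y Wout \<omega> \<rho>s = mf.first_var \<rho>s \<omega>" for \<omega>
    by (simp add: first_variation_def mf.first_var_def mf.out_def logit_def)
  show ?thesis
    unfolding risk var
    using mf.minimizer_iff_msupp[OF assms(10)] mf.minimizer_iff_AE[OF assms(10)] by simp
qed

end
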